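(* If $\mathrm{CE}_2\le\varepsilon$, then for every $\delta>0$, $$\Pr_{[x]\sim D_X}\big[W_1([x])>2\varepsilon/\delta\big]\le\delta.$$ In particular, the 2-snapshot predictor $g$ satisfies, with $\varepsilon'=2\varepsilon/\delta$, the relaxed calibration condition $\Pr_{[x]\sim D_X}\big[W_1(g(x),\mathrm{proj}_2f^*([x]))>\varepsilon'\big]\le\delta$. However, $\mathrm{CE}_2\le\varepsilon$ does not in general imply a uniform (worst-case) bound on $W_1([x])$ over all partition elements.
   Context: $X$ is a random input in $\mathcal X$ with law $D_X$, $f^*(x)=P(Y=1\mid X=x)$ for a label $Y\in\{0,1\}$. A partition $[\cdot]$ of $\mathcal X$ is fixed; $[x]$ denotes the element containing $x$. A higher-order predictor $(m,\sigma^2)$, with $m\in[0,1]$, $\sigma^2\in[0,m(1-m)]$, is constant on partition elements, with values $m([x])$, $\sigma^2([x])$, and $v([x])=m([x])^2+\sigma^2([x])$. Put $\eta_j([x])=\mathbb E[f^*(X)^j\mid X\in[x]]$ for $j=1,2$, $\delta_1([x])=|\eta_1([x])-m([x])|$, $\delta_2([x])=|\eta_2([x])-v([x])|$, and $\mathrm{CE}_2=\mathbb E_{[x]\sim D_X}[\delta_1([x])+\delta_2([x])]$. A 2-snapshot is a pair $(y_1,y_2)\in\{0,1\}^2$ with $y_1,y_2$ i.i.d. $\mathrm{Bernoulli}(f^*(x))$ given $x$; it is identified with its empirical distribution on $\{0,1\}$, so the symmetrized snapshot space is $Y^{(2)}=\{0,\tfrac12,1\}$ (the atom is the fraction of ones),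 a subset of the set $\Delta Y$ of distributions on $\{0,1\}$. $\mathrm{proj}_2f^*([x])$ is the true distribution on $Y^{(2)}$ of symmetrized 2-snapshots drawn from $[x]$ (draw $X$ conditionally on $X\in[x]$, then two i.i.d. labels). The 2-snapshot predictor associated with $(m,\sigma^2)$ is $g(x)=(q_0,q_{1/2},q_1)\in\Delta Y^{(2)}$ with $q_1=v([x])$, $q_{1/2}=2(m([x])-v([x]))$, $q_0=1-2m([x])+v([x])$. $W_1([x])=W_1\big(g(x),\mathrm{proj}_2f^*([x])\big)$ is the Wasserstein-1 distance with ground metric the $\ell_1$ distance on $\Delta Y$ (so $d(0,\tfrac12)=d(\tfrac12,1)=1$, $d(0,1)=2$). A worst-case bound at level $\varepsilon'$ means $W_1([x])\le\varepsilon'$ for every partition element $[x]$. *)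

theory Defs
  imports "HOL-Probability.Probability" "HOL-Library.Disjoint_Sets"
begin

section \<open>Partitions and conditional laws\<close>

definition cell :: "'x set set \<Rightarrow> 'x \<Rightarrow> 'x set" where
  "cell P x = (THE c. c \<in> P \<and> x \<in> c)"

text \<open>
  \<open>K c\<close> is the law of \<open>X\<close> conditionally on \<open>X \<in> c\<close>, where \<open>D\<close> is the law of \<open>X\<close>. On cells of
  positive probability it is forced to be the elementary conditional law
  (\<open>conditional_laws_unique\<close>), and for countable partitions into such cells it always exists
  (\<open>conditional_laws_uniform_measure\<close>). Working with a disintegration also gives a meaning to
  \<open>E[\<dots> | X \<in> c]\<close> for partitions with cells of probability 0, such as level sets.
\<close>

definition conditional_laws :: "'x measure \<Rightarrow> 'x set set \<Rightarrow> ('x set \<Rightarrow> 'x measure) \<Rightarrow> bool" where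
  "conditional_laws D P K \<longleftrightarrow>
     (\<forall>c\<in>P. c \<in> sets D \<and> K c \<in> space (prob_algebra D) \<and> emeasure (K c) c = 1) \<and>
     (\<lambda>x. K (cell P x)) \<in> D \<rightarrow>\<^sub>M prob_algebra D \<and>
     (\<forall>A\<in>sets D. emeasure D A = (\<integral>\<^sup>+x. emeasure (K (cell P x)) A \<partial>D))"

section \<open>Snapshots and the Wasserstein distance\<close>

text \<open>
  A distribution on \<open>{0, 1}\<close> is a \<open>bool pmf\<close> (\<open>True\<close> is the label 1). The symmetrized snapshot
  with fraction of ones \<open>r \<in> {0, 1/2, 1}\<close> stands for the distribution \<open>bernoulli_pmf r\<close>.
\<close>

definition l1_dist :: "bool pmf \<Rightarrow> bool pmf \<Rightarrow> real" where
  "l1_dist p q = (\<Sum>y\<in>UNIV. \<bar>pmf p y - pmf q y\<bar>)"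

definition snapshot_dist :: "real \<Rightarrow> real \<Rightarrow> real" where
  "snapshot_dist r s = l1_dist (bernoulli_pmf r) (bernoulli_pmf s)"

definition fraction_of_ones :: "bool \<times> bool \<Rightarrow> real" where
  "fraction_of_ones = (\<lambda>(y1, y2). (of_bool y1 + of_bool y2) / 2)"

definition snapshot2 :: "real \<Rightarrow> real pmf" where
  "snapshot2 p = map_pmf fraction_of_ones (pair_pmf (bernoulli_pmf p) (bernoulli_pmf p))"

definition proj2 :: "('x set \<Rightarrow> 'x measure) \<Rightarrow> ('x \<Rightarrow> real) \<Rightarrow> 'x set \<Rightarrow> real pmf" where
  "proj2 K f c = embed_pmf (\<lambda>r. \<integral>x. pmf (snapshot2 (f x)) r \<partial>K c)"

definition wasserstein1 :: "('a \<Rightarrow> 'a \<Rightarrow> real) \<Rightarrow> 'a pmf \<Rightarrow> 'a pmf \<Rightarrow> real" where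
  "wasserstein1 d p q =
     (INF \<gamma>\<in>{\<gamma>. map_pmf fst \<gamma> = p \<and> map_pmf snd \<gamma> = q}.
        measure_pmf.expectation \<gamma> (\<lambda>(a, b). d a b))"

section \<open>Higher-order predictors\<close>

text \<open>
  A function on \<open>'x\<close> that is constant on the cells is given as a function of the cell; the
  predictor consists of the mean \<open>m\<close> and the variance \<open>s\<close>.
\<close>

definition second_moment :: "('x set \<Rightarrow> real) \<Rightarrow> ('x set \<Rightarrow> real) \<Rightarrow> 'x set \<Rightarrow> real" where
  "second_moment m s c = (m c)\<^sup>2 + s c"

definition snapshot_predictor :: "('x set \<Rightarrow> real) \<Rightarrow> ('x set \<Rightarrow> real) \<Rightarrow> 'x set \<Rightarrow> real pmf" where
  "snapshot_predictor m s c =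
     embed_pmf (\<lambda>r. if r = 1 then second_moment m s c
                    else if r = 1/2 then 2 * (m c - second_moment m s c)
                    else if r = 0 then 1 - 2 * m c + second_moment m s c
                    else 0)"

locale higher_order_setup = prob_space \<Omega>
  for \<Omega> :: "'w measure" +
  fixes S :: "'x measure"
    and X :: "'w \<Rightarrow> 'x"
    and Y :: "'w \<Rightarrow> bool"
    and f :: "'x \<Rightarrow> real"
    and P :: "'x set set"
    and K :: "'x set \<Rightarrow> 'x measure"
    and m s :: "'x set \<Rightarrow> real"
  assumes X: "X \<in> \<Omega> \<rightarrow>\<^sub>M S"
    and Y: "Y \<in> \<Omega> \<rightarrow>\<^sub>M count_space UNIV"
    and f_measurable: "f \<in> borel_measurable S"
    and f_range: "\<And>x. x \<in> space S \<Longrightarrow> f x \<in> {0..1}"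
    and f_cond_prob:
      "AE \<omega> in \<Omega>. f (X \<omega>) =
         real_cond_exp \<Omega> (vimage_algebra (space \<Omega>) X S) (\<lambda>\<omega>. of_bool (Y \<omega>)) \<omega>"
    and partition: "partition_on (space S) P"
    and cond: "conditional_laws (distr \<Omega> S X) P K"
    and m_measurable: "(\<lambda>x. m (cell P x)) \<in> borel_measurable S"
    and s_measurable: "(\<lambda>x. s (cell P x)) \<in> borel_measurable S"
    and m_range: "\<And>c. c \<in> P \<Longrightarrow> m c \<in> {0..1}"
    and s_range: "\<And>c. c \<in> P \<Longrightarrow> s c \<in> {0..m c * (1 - m c)}"

definition eta :: "('x set \<Rightarrow> 'x measure) \<Rightarrow> ('x \<Rightarrow> real) \<Rightarrow> nat \<Rightarrow> 'x set \<Rightarrow> real" where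
  "eta K f j c = (\<integral>x. f x ^ j \<partial>K c)"

definition delta1 ::
  "('x set \<Rightarrow> 'x measure) \<Rightarrow> ('x \<Rightarrow> real) \<Rightarrow> ('x set \<Rightarrow> real) \<Rightarrow> 'x set \<Rightarrow> real" where
  "delta1 K f m c = \<bar>eta K f 1 c - m c\<bar>"

definition delta2 ::
  "('x set \<Rightarrow> 'x measure) \<Rightarrow> ('x \<Rightarrow> real) \<Rightarrow> ('x set \<Rightarrow> real) \<Rightarrow> ('x set \<Rightarrow> real) \<Rightarrow> 'x set \<Rightarrow> real" where
  "delta2 K f m s c = \<bar>eta K f 2 c - second_moment m s c\<bar>"

text \<open>In the following, \<open>D\<close> is the law of \<open>X\<close>.\<close>

definition CE2 ::
  "'x measure \<Rightarrow> 'x set set \<Rightarrow> ('x set \<Rightarrow> 'x measure) \<Rightarrow> ('x \<Rightarrow> real) \<Rightarrow>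
   ('x set \<Rightarrow> real) \<Rightarrow> ('x set \<Rightarrow> real) \<Rightarrow> real" where
  "CE2 D P K f m s = (\<integral>x. delta1 K f m (cell P x) + delta2 K f m s (cell P x) \<partial>D)"

definition W1 ::
  "('x set \<Rightarrow> 'x measure) \<Rightarrow> ('x \<Rightarrow> real) \<Rightarrow> ('x set \<Rightarrow> real) \<Rightarrow> ('x set \<Rightarrow> real) \<Rightarrow> 'x set \<Rightarrow> real" where
  "W1 K f m s c = wasserstein1 snapshot_dist (snapshot_predictor m s c) (proj2 K f c)"

text \<open>Here \<open>g\<close> is a snapshot predictor, as a function of the cell.\<close>

definition relaxed_calibrated ::
  "'x measure \<Rightarrow> 'x set set \<Rightarrow> ('x set \<Rightarrow> 'x measure) \<Rightarrow> ('x \<Rightarrow> real) \<Rightarrow>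
   ('x set \<Rightarrow> real pmf) \<Rightarrow> real \<Rightarrow> real \<Rightarrow> bool" where
  "relaxed_calibrated D P K f g \<epsilon>' \<delta> \<longleftrightarrow>
     measure D {x \<in> space D. wasserstein1 snapshot_dist (g (cell P x)) (proj2 K f (cell P x)) > \<epsilon>'} \<le> \<delta>"

definition worst_case_bound ::
  "'x set set \<Rightarrow> ('x set \<Rightarrow> 'x measure) \<Rightarrow> ('x \<Rightarrow> real) \<Rightarrow>
   ('x set \<Rightarrow> real) \<Rightarrow> ('x set \<Rightarrow> real) \<Rightarrow> real \<Rightarrow> bool" where
  "worst_case_bound P K f m s \<epsilon>' \<longleftrightarrow> (\<forall>c\<in>P. W1 K f m s c \<le> \<epsilon>')"

section \<open>Well-definedness\<close>

lemma cell_eqI: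
  assumes "partition_on A P" "c \<in> P" "x \<in> c"
  shows "cell P x = c"
  unfolding cell_def
  using assms by (intro the_equality) (auto simp: partition_on_def disjoint_def)

lemma cell_in:
  assumes "partition_on A P" "x \<in> A"
  shows "cell P x \<in> P" "x \<in> cell P x"
proof -
  obtain c where "c \<in> P" "x \<in> c" using assms by (auto simp: partition_on_def)
  then show "cell P x \<in> P" "x \<in> cell P x" using cell_eqI[OF assms(1)] by auto
qed

lemma conditional_laws_unique:
  assumes D: "prob_space D" and P: "partition_on (space D) P" and K: "conditional_laws D P K"
    and c: "c \<in> P" "measure D c > 0"
  shows "K c = uniform_measure D c"
proof (rule measure_eqI)
  interpret D: prob_space D by fact
  have Kc: "c \<in> sets D" "sets (K c) = sets D" "prob_space (K c)" "emeasure (K c) c = 1"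
    if "c \<in> P" for c
    using K that by (auto simp: conditional_laws_def space_prob_algebra)
  show "sets (K c) = sets (uniform_measure D c)" using Kc c by simp
  fix A assume "A \<in> sets (K c)"
  then have A: "A \<in> sets D" using Kc c by simp
  have inC: "emeasure (K b) (A \<inter> b) = emeasure (K b) A" if b: "b \<in> P" for b
  proof -
    interpret Kb: prob_space "K b" using Kc b by blast
    have "AE x in K b. x \<in> b"
      using Kc[OF b] by (intro Kb.AE_prob_1) (simp add: measure_def)
    then show ?thesis
      using Kc[OF b] A by (intro emeasure_eq_AE) auto
  qed
  have other: "emeasure (K b) (A \<inter> c) = 0" if b: "b \<in> P" "b \<noteq> c" for b
  proof -
    interpret Kb: prob_space "K b" using Kc b by blast
    have "AE x in K b. x \<in> b"
      using Kc[OF b(1)] by (intro Kb.AE_prob_1) (simp add: measure_def)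
    moreover have "b \<inter> c = {}"
      using P b c by (auto simp: partition_on_def disjoint_def)
    ultimately have "AE x in K b. x \<notin> A \<inter> c" by (auto elim!: eventually_mono)
    moreover have Ac: "A \<inter> c \<in> sets (K b)"
      using Kc[OF b(1)] Kc(1)[OF c(1)] A by auto
    moreover have "{x \<in> space (K b). \<not> x \<notin> A \<inter> c} = A \<inter> c"
      using sets.sets_into_space[OF Ac] by auto
    ultimately show ?thesis by (simp only: AE_iff_measurable)
  qed
  have "emeasure D (A \<inter> c) = (\<integral>\<^sup>+x. emeasure (K (cell P x)) (A \<inter> c) \<partial>D)"
    using K A Kc(1)[OF c(1)] by (simp add: conditional_laws_def)
  also have "\<dots> = (\<integral>\<^sup>+x. emeasure (K c) A * indicator c x \<partial>D)"
  proof (rule nn_integral_cong)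
    fix x assume x: "x \<in> space D"
    show "emeasure (K (cell P x)) (A \<inter> c) = emeasure (K c) A * indicator c x"
      using cell_in[OF P x] cell_eqI[OF P c(1), of x] inC[OF c(1)] other[of "cell P x"]
      by (cases "x \<in> c") auto
  qed
  also have "\<dots> = emeasure (K c) A * emeasure D c"
    using Kc(1)[OF c(1)] by (simp add: nn_integral_cmult_indicator)
  finally show "emeasure (K c) A = emeasure (uniform_measure D c) A"
    using A Kc(1)[OF c(1)] c(2)
    by (simp add: Int_commute D.emeasure_eq_measure ennreal_mult_divide_eq)
qed

lemma conditional_laws_uniform_measure:
  assumes D: "prob_space D" and P: "partition_on (space D) P" and "countable P"
    and c: "\<And>c. c \<in> P \<Longrightarrow> c \<in> sets D \<and> measure D c > 0"
  shows "conditional_laws D P (uniform_measure D)"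
proof -
  interpret D: prob_space D by fact
  have pos: "emeasure D c \<noteq> 0" "emeasure D c \<noteq> \<infinity>" if "c \<in> P" for c
    using c[OF that] by (auto simp: D.emeasure_eq_measure)
  have meas: "cell P \<in> D \<rightarrow>\<^sub>M count_space P"
  proof (subst measurable_count_space_eq_countable[OF \<open>countable P\<close>], safe)
    fix x assume "x \<in> space D" then show "cell P x \<in> P" using cell_in[OF P] by auto
  next
    fix b assume b: "b \<in> P"
    have "cell P -` {b} \<inter> space D = b"
      using cell_in[OF P] cell_eqI[OF P b] sets.sets_into_space c b by blast
    then show "cell P -` {b} \<inter> space D \<in> sets D" using c b by simp
  qed
  have K: "uniform_measure D b \<in> space (prob_algebra D)" if "b \<in> P" for b
    using pos[OF that] by (auto simp: space_prob_algebra intro!: prob_space_uniform_measure)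
  have "emeasure D A = (\<integral>\<^sup>+x. emeasure (uniform_measure D (cell P x)) A \<partial>D)"
    if A: "A \<in> sets D" for A
  proof -
    have "emeasure D A = emeasure D (\<Union>b\<in>P. A \<inter> b)"
      using P sets.sets_into_space[OF A] by (intro arg_cong[of _ _ "emeasure D"]) (auto simp: partition_on_def)
    also have "\<dots> = (\<integral>\<^sup>+b. emeasure D (A \<inter> b) \<partial>count_space P)"
    proof (rule emeasure_UN_countable)
      show "disjoint_family_on (\<lambda>b. A \<inter> b) P"
        using P unfolding partition_on_def disjoint_def disjoint_family_on_def by blast
    qed (use c A \<open>countable P\<close> in auto)
    also have "\<dots> = (\<integral>\<^sup>+b. (\<integral>\<^sup>+x. emeasure (uniform_measure D b) A * indicator b x \<partial>D) \<partial>count_space P)"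
    proof (rule nn_integral_cong)
      fix b assume "b \<in> space (count_space P)"
      then have b: "b \<in> P" by simp
      show "emeasure D (A \<inter> b) = (\<integral>\<^sup>+x. emeasure (uniform_measure D b) A * indicator b x \<partial>D)"
        using A c[OF b] pos[OF b]
        by (simp add: nn_integral_cmult_indicator Int_commute ennreal_divide_times
              ennreal_divide_self D.emeasure_eq_measure divide_ennreal ennreal_mult[symmetric])
    qed
    also have "\<dots> = (\<integral>\<^sup>+x. (\<integral>\<^sup>+b. emeasure (uniform_measure D b) A * indicator b x \<partial>count_space P) \<partial>D)"
      using c A \<open>countable P\<close> by (intro nn_integral_count_space_nn_integral[symmetric])
         (auto intro!: borel_measurable_times_ennreal borel_measurable_indicator)
    also have "\<dots> = (\<integral>\<^sup>+x. emeasure (uniform_measure D (cell P x)) A \<partial>D)"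
    proof (rule nn_integral_cong)
      fix x assume x: "x \<in> space D"
      have "(\<integral>\<^sup>+b. emeasure (uniform_measure D b) A * indicator b x \<partial>count_space P)
          = (\<integral>\<^sup>+b. emeasure (uniform_measure D (cell P x)) A * indicator {cell P x} b \<partial>count_space P)"
      proof (rule nn_integral_cong)
        fix b assume "b \<in> space (count_space P)"
        then have "x \<in> b \<longleftrightarrow> b = cell P x"
          using cell_in[OF P x] cell_eqI[OF P, of b x] by auto
        then show "emeasure (uniform_measure D b) A * indicator b x
            = emeasure (uniform_measure D (cell P x)) A * indicator {cell P x} b"
          by (cases "x \<in> b") auto
      qed
      also have "\<dots> = emeasure (uniform_measure D (cell P x)) A"
        using cell_in[OF P x] by (subst nn_integral_cmult_indicator) auto
      finally show "(\<integral>\<^sup>+b. emeasure (uniform_measure D b) A * indicator b x \<partial>count_space P)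
          = emeasure (uniform_measure D (cell P x)) A" .
    qed
    finally show ?thesis .
  qed
  moreover have "(\<lambda>x. uniform_measure D (cell P x)) \<in> D \<rightarrow>\<^sub>M prob_algebra D"
    using K by (intro measurable_compose[OF meas]) auto
  moreover have "emeasure (uniform_measure D b) b = 1" if "b \<in> P" for b
    using c[OF that] pos[OF that] by (simp add: D.emeasure_eq_measure divide_ennreal)
  ultimately show ?thesis using K c by (simp add: conditional_laws_def)
qed

lemma nn_integral_three_atoms:
  fixes a b c :: real
  assumes "0 \<le> a" "0 \<le> b" "0 \<le> c" "a + b + c = 1"
    and "h 1 = a" "h (1/2) = b" "h 0 = c" "\<And>r. r \<notin> {0, 1/2, 1::real} \<Longrightarrow> h r = (0::real)"
  shows "(\<integral>\<^sup>+r. ennreal (h r) \<partial>count_space UNIV) = 1"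
proof -
  have "(\<integral>\<^sup>+r. ennreal (h r) \<partial>count_space UNIV) = (\<Sum>r\<in>{0, 1/2, 1}. ennreal (h r))"
    using assms(8) by (intro nn_integral_count_space'[where A = "{0, 1/2, 1}"]) auto
  also have "\<dots> = ennreal (c + (b + a))"
    using assms by (simp add: ennreal_plus[symmetric] del: ennreal_plus)
  also have "c + (b + a) = 1" using assms by simp
  finally show ?thesis by simp
qed

lemma pmf_snapshot_predictor:
  assumes "m c \<in> {0..1}" "s c \<in> {0..m c * (1 - m c)}"
  shows "pmf (snapshot_predictor m s c) r =
     (if r = 1 then second_moment m s c
      else if r = 1/2 then 2 * (m c - second_moment m s c)
      else if r = 0 then 1 - 2 * m c + second_moment m s c
      else 0)"
proof -
  have 1: "second_moment m s c \<ge> 0" "m c - second_moment m s c \<ge> 0"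
    using assms by (auto simp: second_moment_def power2_eq_square algebra_simps)
  have "1 - 2 * m c + second_moment m s c = (1 - m c)\<^sup>2 + s c"
    by (simp add: second_moment_def power2_eq_square algebra_simps)
  then have 2: "1 - 2 * m c + second_moment m s c \<ge> 0" using assms by simp
  show ?thesis
    unfolding snapshot_predictor_def
  proof (rule pmf_embed_pmf)
    show "(\<integral>\<^sup>+(r::real). ennreal (if r = 1 then second_moment m s c
        else if r = 1/2 then 2 * (m c - second_moment m s c)
        else if r = 0 then 1 - 2 * m c + second_moment m s c
        else 0) \<partial>count_space UNIV) = 1"
      by (rule nn_integral_three_atoms[of "second_moment m s c"
            "2 * (m c - second_moment m s c)" "1 - 2 * m c + second_moment m s c"])
         (use 1 2 in auto)
  qed (use 1 2 in auto)
qed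

lemma pmf_snapshot2:
  assumes "p \<in> {0..1}"
  shows "pmf (snapshot2 p) r =
     (if r = 1 then p\<^sup>2 else if r = 1/2 then 2 * (p - p\<^sup>2) else if r = 0 then 1 - 2 * p + p\<^sup>2 else 0)"
proof -
  have vim: "fraction_of_ones -` {r} =
     (if r = 1 then {(True, True)} else if r = 1/2 then {(True, False), (False, True)}
      else if r = 0 then {(False, False)} else {})"
  proof -
    have vals: "fraction_of_ones (True, True) = 1" "fraction_of_ones (True, False) = 1/2"
      "fraction_of_ones (False, True) = 1/2" "fraction_of_ones (False, False) = 0"
      by (simp_all add: fraction_of_ones_def)
    have "y \<in> {(True, True), (True, False), (False, True), (False, False)}" for y :: "bool \<times> bool"
      by (cases y) auto
    then have "fraction_of_ones -` {r} =
      {y \<in> {(True, True), (True, False), (False, True), (False, False)}. fraction_of_ones y = r}"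
      by blast
    also have "\<dots> = (if r = 1 then {(True, True)} else if r = 1/2 then {(True, False), (False, True)}
      else if r = 0 then {(False, False)} else {})"
      unfolding Collect_conj_eq Collect_mem_eq
      by (cases "r = 1"; cases "r = 1/2"; cases "r = 0") (auto simp: vals)
    finally show ?thesis .
  qed
  have eq: "pmf (snapshot2 p) r =
     (\<Sum>y\<in>fraction_of_ones -` {r}. pmf (pair_pmf (bernoulli_pmf p) (bernoulli_pmf p)) y)"
    unfolding snapshot2_def pmf_map by (rule measure_measure_pmf_finite) simp
  show ?thesis
    unfolding eq vim using assms by (auto simp: pmf_pair power2_eq_square algebra_simps)
qed

lemma pmf_proj2:
  assumes "prob_space (K c)" "f \<in> borel_measurable (K c)" "\<And>x. x \<in> space (K c) \<Longrightarrow> f x \<in> {0..1}"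
  shows "pmf (proj2 K f c) r = (\<integral>x. pmf (snapshot2 (f x)) r \<partial>K c)"
    and "pmf (proj2 K f c) r =
     (if r = 1 then eta K f 2 c
      else if r = 1/2 then 2 * (eta K f 1 c - eta K f 2 c)
      else if r = 0 then 1 - 2 * eta K f 1 c + eta K f 2 c
      else 0)"
proof -
  interpret prob_space "K c" by fact
  have int: "integrable (K c) (\<lambda>x. f x ^ j)" for j
    using assms(2,3) by (intro integrable_const_bound[where B = 1] AE_I2) (auto intro: power_le_one)
  have int1: "integrable (K c) f" using int[of 1] by simp
  have int2: "integrable (K c) (\<lambda>x. (f x)\<^sup>2)" using int[of 2] .
  let ?h = "\<lambda>r. \<integral>x. pmf (snapshot2 (f x)) r \<partial>K c"
  have h: "?h r = (if r = 1 then eta K f 2 c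
      else if r = 1/2 then 2 * (eta K f 1 c - eta K f 2 c)
      else if r = 0 then 1 - 2 * eta K f 1 c + eta K f 2 c
      else 0)" for r
  proof -
    have "?h r = (\<integral>x. (if r = 1 then (f x)\<^sup>2 else if r = 1/2 then 2 * (f x - (f x)\<^sup>2)
             else if r = 0 then 1 - 2 * f x + (f x)\<^sup>2 else 0) \<partial>K c)"
      using assms(3) by (intro Bochner_Integration.integral_cong refl pmf_snapshot2) auto
    also have "\<dots> = (if r = 1 then eta K f 2 c
      else if r = 1/2 then 2 * (eta K f 1 c - eta K f 2 c)
      else if r = 0 then 1 - 2 * eta K f 1 c + eta K f 2 c
      else 0)"
      using int1 int2 by (simp add: eta_def prob_space)
    finally show ?thesis .
  qed
  have nn: "?h r \<ge> 0" for r by (simp add: integral_nonneg_AE)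
  have "(\<integral>\<^sup>+r. ennreal (?h r) \<partial>count_space UNIV) = 1"
  proof (rule nn_integral_three_atoms[of "?h 1" "?h (1/2)" "?h 0"])
    show "?h 1 + ?h (1/2) + ?h 0 = 1" unfolding h by simp
    show "?h r = 0" if "r \<notin> {0, 1/2, 1}" for r unfolding h using that by simp
  qed (use nn in auto)
  then show 1: "pmf (proj2 K f c) r = ?h r"
    unfolding proj2_def by (intro pmf_embed_pmf nn)
  show "pmf (proj2 K f c) r = (if r = 1 then eta K f 2 c
      else if r = 1/2 then 2 * (eta K f 1 c - eta K f 2 c)
      else if r = 0 then 1 - 2 * eta K f 1 c + eta K f 2 c
      else 0)"
    unfolding 1 by (rule h)
qed

end

theory Submission
  imports Defs
begin

text \<open>
  On the line \<open>0 - 1/2 - 1\<close> the monotone coupling has cost \<open>\<bar>F 0 - G 0\<bar> + \<bar>F (1/2) - G (1/2)\<bar>\<close> in terms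
  of the distribution functions; for the snapshot laws this is at most
  \<open>(2 \<delta>\<^sub>1 + \<delta>\<^sub>2) + \<delta>\<^sub>2\<close>, and Markov's inequality applies. For the negative part, a predictor that is wrong
  by the maximal amount on a cell of small probability has small \<open>CE2\<close>, but \<open>W1 = 2\<close> on that cell.
\<close>

section \<open>Wasserstein distance: basic facts\<close>

lemma snapshot_dist_eq:
  assumes "r \<in> {0..1}" "s \<in> {0..1}"
  shows "snapshot_dist r s = 2 * \<bar>r - s\<bar>"
  using assms by (simp add: snapshot_dist_def l1_dist_def UNIV_bool)

text \<open>An infimum of reals lies below its members only if they are bounded below; nonnegativity
  of \<open>d\<close> gives the bound 0.\<close>

lemma wasserstein1_le_expectation:
  assumes "\<And>a b. d a b \<ge> 0" "map_pmf fst \<gamma> = p" "map_pmf snd \<gamma> = q"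
  shows "wasserstein1 d p q \<le> measure_pmf.expectation \<gamma> (\<lambda>(a, b). d a b)"
  unfolding wasserstein1_def
proof (rule cINF_lower)
  show "bdd_below ((\<lambda>\<gamma>. measure_pmf.expectation \<gamma> (\<lambda>(a, b). d a b)) `
      {\<gamma>. map_pmf fst \<gamma> = p \<and> map_pmf snd \<gamma> = q})"
    using assms(1) by (intro bdd_belowI[of _ 0]) (auto intro!: integral_nonneg_AE)
qed (use assms in auto)

text \<open>Two point masses have only one coupling, so the infimum runs over a singleton. This
  gives the exact value in the counterexample.\<close>

lemma wasserstein1_return_pmf:
  "wasserstein1 d (return_pmf a) (return_pmf b) = d a b"
proof -
  have "\<gamma> = return_pmf (a, b)" if "map_pmf fst \<gamma> = return_pmf a" "map_pmf snd \<gamma> = return_pmf b" for \<gamma>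
    using that unfolding map_pmf_eq_return_pmf_iff
    by (metis prod.collapse set_pmf_not_empty set_pmf_subset_singleton subsetI insertI1 singletonI)
  then have "{\<gamma>. map_pmf fst \<gamma> = return_pmf a \<and> map_pmf snd \<gamma> = return_pmf b} = {return_pmf (a, b)}"
    by auto
  then show ?thesis by (simp add: wasserstein1_def)
qed

section \<open>Monotone coupling of laws on three atoms\<close>

text \<open>
  For \<open>a \<le> b\<close> and \<open>c \<le> d\<close>, this is the length of the intersection of \<open>[a, b]\<close> and \<open>[c, d]\<close>, in a form
  that telescopes. The overlaps of the quantile intervals of two laws form their monotone coupling.
\<close>

definition overlap :: "real \<Rightarrow> real \<Rightarrow> real \<Rightarrow> real \<Rightarrow> real" where
  "overlap a b c d = min b (max a d) - min b (max a c)"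

lemma overlap_nonneg: "c \<le> d \<Longrightarrow> overlap a b c d \<ge> 0"
  by (auto simp: overlap_def)

lemma overlap_commute:
  assumes "a \<le> b" "c \<le> d"
  shows "overlap a b c d = overlap c d a b"
  using assms unfolding overlap_def min_def max_def by (simp split: if_split)

text \<open>The sum telescopes to \<open>min b (max a 1) - min b (max a 0)\<close>. It computes the
  marginals of the coupling.\<close>

lemma overlap_sum:
  assumes "0 \<le> a" "a \<le> b" "b \<le> 1"
  shows "overlap a b 0 c + overlap a b c d + overlap a b d 1 = b - a"
  using assms by (simp add: overlap_def)

text \<open>The second summand is the gap between the distribution functions at 1/2, because the
  atom 1 carries the remaining mass.\<close>

lemma wasserstein1_three_atoms:
  fixes p q :: "real pmf"
  assumes p: "\<And>r. r \<notin> {0, 1/2, 1} \<Longrightarrow> pmf p r = 0" "pmf p 0 + pmf p (1/2) + pmf p 1 = 1"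
    and q: "\<And>r. r \<notin> {0, 1/2, 1} \<Longrightarrow> pmf q r = 0" "pmf q 0 + pmf q (1/2) + pmf q 1 = 1"
  shows "wasserstein1 snapshot_dist p q \<le> \<bar>pmf p 0 - pmf q 0\<bar> + \<bar>pmf p 1 - pmf q 1\<bar>"
proof -
  \<comment> \<open>Cumulative masses: \<open>[0, a]\<close>, \<open>[a, b]\<close>,
    \<open>[b, 1]\<close> are the quantile intervals of the atoms 0, 1/2, 1 under \<open>p\<close>;
    likewise \<open>c\<close> and \<open>d\<close> for \<open>q\<close>.\<close>
  define a b c d where abcd: "a = pmf p 0" "b = pmf p 0 + pmf p (1/2)"
    "c = pmf q 0" "d = pmf q 0 + pmf q (1/2)"
  have le: "0 \<le> a" "a \<le> b" "b \<le> 1" "0 \<le> c" "c \<le> d" "d \<le> 1"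
    unfolding abcd using p(2) q(2) pmf_nonneg[of p 0] pmf_nonneg[of p "1/2"] pmf_nonneg[of p 1]
      pmf_nonneg[of q 0] pmf_nonneg[of q "1/2"] pmf_nonneg[of q 1]
    by linarith+
  have p_eq: "pmf p 0 = a - 0" "pmf p (1/2) = b - a" "pmf p 1 = 1 - b"
    and q_eq: "pmf q 0 = c - 0" "pmf q (1/2) = d - c" "pmf q 1 = 1 - d"
    using p(2) q(2) by (auto simp: abcd)
  \<comment> \<open>The pair \<open>(r, s)\<close> gets the overlap of the interval of
    \<open>r\<close> under \<open>p\<close> with that of \<open>s\<close> under
    \<open>q\<close>.\<close>
  define xs where "xs =
    [((0::real, 0::real), overlap 0 a 0 c), ((0, 1/2), overlap 0 a c d), ((0, 1), overlap 0 a d 1),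
     ((1/2, 0), overlap a b 0 c), ((1/2, 1/2), overlap a b c d), ((1/2, 1), overlap a b d 1),
     ((1, 0), overlap b 1 0 c), ((1, 1/2), overlap b 1 c d), ((1, 1), overlap b 1 d 1)]"
  have fst_sums: "overlap 0 a 0 c + overlap 0 a c d + overlap 0 a d 1 = a - 0"
    "overlap a b 0 c + overlap a b c d + overlap a b d 1 = b - a"
    "overlap b 1 0 c + overlap b 1 c d + overlap b 1 d 1 = 1 - b"
    by (rule overlap_sum; use le in linarith)+
  \<comment> \<open>The second marginal is the same tiling with \<open>p\<close> and
    \<open>q\<close> exchanged, carried back by symmetry of \<open>overlap\<close>.\<close>
  have "overlap 0 c 0 a + overlap 0 c a b + overlap 0 c b 1 = c - 0"
    "overlap c d 0 a + overlap c d a b + overlap c d b 1 = d - c"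
    "overlap d 1 0 a + overlap d 1 a b + overlap d 1 b 1 = 1 - d"
    by (rule overlap_sum; use le in linarith)+
  then have snd_sums: "overlap 0 a 0 c + overlap a b 0 c + overlap b 1 0 c = c - 0"
    "overlap 0 a c d + overlap a b c d + overlap b 1 c d = d - c"
    "overlap 0 a d 1 + overlap a b d 1 + overlap b 1 d 1 = 1 - d"
    using le by (simp_all add: overlap_commute[of 0 a] overlap_commute[of a b] overlap_commute[of b 1])
  have wf: "pmf_of_list_wf xs"
    using fst_sums le by (intro pmf_of_list_wfI) (auto simp: xs_def overlap_nonneg)
  define \<gamma> where "\<gamma> = pmf_of_list xs"
  have marginals: "map_pmf fst \<gamma> = p" "map_pmf snd \<gamma> = q"
  proof -
    have "pmf (map_pmf fst \<gamma>) r = pmf p r \<and> pmf (map_pmf snd \<gamma>) r = pmf q r" for r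
      unfolding pmf_map \<gamma>_def measure_pmf_of_list[OF wf]
      using fst_sums snd_sums p(1)[of r] q(1)[of r] unfolding xs_def
      by (cases "r = 0"; cases "r = 1/2"; cases "r = 1") (auto simp: p_eq q_eq simp del: eq_divide_eq_numeral1)
    then show "map_pmf fst \<gamma> = p" "map_pmf snd \<gamma> = q" by (auto intro: pmf_eqI)
  qed
  have "wasserstein1 snapshot_dist p q \<le> measure_pmf.expectation \<gamma> (\<lambda>(r, s). snapshot_dist r s)"
    by (intro wasserstein1_le_expectation marginals) (simp add: snapshot_dist_def l1_dist_def sum_nonneg)
  also have "\<dots> = (\<Sum>z\<in>set (map fst xs). (case z of (r, s) \<Rightarrow> snapshot_dist r s) * pmf \<gamma> z)"
    using set_pmf_of_list[OF wf] by (intro integral_measure_pmf_real) (auto simp: \<gamma>_def)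
  also have "\<dots> = overlap 0 a c d + 2 * overlap 0 a d 1 + overlap a b 0 c + overlap a b d 1
      + 2 * overlap b 1 0 c + overlap b 1 c d"
    unfolding \<gamma>_def pmf_pmf_of_list[OF wf] by (simp add: xs_def snapshot_dist_eq)
  \<comment> \<open>With \<open>min a c\<close> staying at \<open>(0, 0)\<close> and
    \<open>1 - max b d\<close> at \<open>(1, 1)\<close>, the marginals show that mass
    \<open>\<bar>a - c\<bar>\<close> crosses between 0 and 1/2 and mass
    \<open>\<bar>b - d\<bar>\<close> between 1/2 and 1. Mass moved from end to end crosses both
    gaps, hence the coefficient 2.\<close>
  also have "\<dots> = \<bar>a - c\<bar> + \<bar>b - d\<bar>"
  proof -
    have "overlap 0 a 0 c = min a c" "overlap b 1 d 1 = 1 - max b d"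
      using le by (simp_all add: overlap_def)
    then show ?thesis using fst_sums snd_sums by linarith
  qed
  finally show ?thesis by (simp add: p_eq q_eq)
qed

section \<open>Calibration error and the tail bound\<close>

context higher_order_setup
begin

abbreviation "D \<equiv> distr \<Omega> S X"

lemma conditional_law:
  assumes "c \<in> P"
  shows "prob_space (K c)" "sets (K c) = sets S" "space (K c) = space S" "f \<in> borel_measurable (K c)"
proof -
  show 1: "prob_space (K c)" "sets (K c) = sets S"
    using cond assms by (auto simp: conditional_laws_def space_prob_algebra)
  from 1(2) show "space (K c) = space S" by (rule sets_eq_imp_space_eq)
  show "f \<in> borel_measurable (K c)" using f_measurable measurable_cong_sets[OF 1(2) refl] by auto
qed

lemma W1_le:
  assumes c: "c \<in> P"
  shows "W1 K f m s c \<le> 2 * (delta1 K f m c + delta2 K f m s c)"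
proof -
  let ?p = "snapshot_predictor m s c" and ?q = "proj2 K f c"
  have q: "pmf ?q r =
     (if r = 1 then eta K f 2 c
      else if r = 1/2 then 2 * (eta K f 1 c - eta K f 2 c)
      else if r = 0 then 1 - 2 * eta K f 1 c + eta K f 2 c
      else 0)" for r
    using conditional_law[OF c] f_range by (intro pmf_proj2(2)) auto
  note p = pmf_snapshot_predictor[of m c s, OF m_range[OF c] s_range[OF c]]
  have "W1 K f m s c \<le> \<bar>pmf ?p 0 - pmf ?q 0\<bar> + \<bar>pmf ?p 1 - pmf ?q 1\<bar>"
    unfolding W1_def by (rule wasserstein1_three_atoms) (auto simp: p q)
  \<comment> \<open>With \<open>v\<close> the second moment, the difference at atom 0 is
    \<open>2 * (eta K f 1 c - m c) - (eta K f 2 c - v)\<close>; atom 1 contributes exactly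
    \<open>delta2\<close>.\<close>
  also have "\<dots> \<le> 2 * (delta1 K f m c + delta2 K f m s c)"
    by (simp add: p q delta1_def delta2_def abs_if)
  finally show ?thesis .
qed

lemma eta_range:
  assumes c: "c \<in> P"
  shows "eta K f j c \<in> {0..1}"
proof -
  interpret K: prob_space "K c" by (rule conditional_law[OF c])
  have "integrable (K c) (\<lambda>x. f x ^ j)"
    using conditional_law[OF c] f_range
    by (intro K.integrable_const_bound[where B = 1] AE_I2) (auto intro: power_le_one)
  then have "eta K f j c \<le> (\<integral>x. 1 \<partial>K c)"
    unfolding eta_def using conditional_law[OF c] f_range
    by (intro integral_mono) (auto intro: power_le_one)
  moreover have "eta K f j c \<ge> 0"
    unfolding eta_def using conditional_law[OF c] f_range by (intro Bochner_Integration.integral_nonneg) auto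
  ultimately show ?thesis by (simp add: K.prob_space)
qed

text \<open>The variance bound \<open>s c \<le> m c * (1 - m c)\<close> says precisely that the
  second moment is at most \<open>m c\<close>.\<close>

lemma second_moment_range:
  assumes "c \<in> P"
  shows "second_moment m s c \<in> {0..1}"
proof -
  have "second_moment m s c \<le> m c"
    using s_range[OF assms] by (simp add: second_moment_def power2_eq_square algebra_simps)
  then show ?thesis
    using m_range[OF assms] s_range[OF assms] by (auto simp: second_moment_def)
qed

text \<open>The kernel \<open>K (cell P x)\<close> is measurable in \<open>x\<close>, and
  integrating a fixed measurable function is measurable in the measure.\<close>

lemma eta_measurable: "(\<lambda>x. eta K f j (cell P x)) \<in> borel_measurable D"
proof -
  have "(\<lambda>x. K (cell P x)) \<in> D \<rightarrow>\<^sub>M subprob_algebra D"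
    using cond by (auto simp: conditional_laws_def intro: measurable_prob_algebraD)
  moreover have "(\<lambda>x. f x ^ j) \<in> borel_measurable D" using f_measurable by simp
  ultimately show ?thesis
    unfolding eta_def by (rule measurable_compose[OF _ integral_measurable_subprob_algebra])
qed

text \<open>A non-integrable function has integral 0 by convention, so integrability is what gives a
  bound on \<open>CE2\<close> its content. Each error is a distance between points of
  \<open>[0, 1]\<close>, hence the bound 2.\<close>

lemma integrable_calibration_error:
  "integrable D (\<lambda>x. delta1 K f m (cell P x) + delta2 K f m s (cell P x))"
proof -
  interpret D: prob_space D by (rule prob_space_distr[OF X])
  have "norm (delta1 K f m c + delta2 K f m s c) \<le> 2" if "c \<in> P" for c
    using eta_range[OF that, of 1] eta_range[OF that, of 2] m_range[OF that] second_moment_range[OF that]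
    by (auto simp: delta1_def delta2_def)
  moreover have "(\<lambda>x. delta1 K f m (cell P x) + delta2 K f m s (cell P x)) \<in> borel_measurable D"
    unfolding delta1_def delta2_def second_moment_def
    using eta_measurable m_measurable s_measurable
    by (intro borel_measurable_add borel_measurable_abs borel_measurable_diff borel_measurable_power)
       auto
  ultimately show ?thesis
    using cell_in(1)[OF partition] by (intro D.integrable_const_bound[where B = 2] AE_I2) auto
qed

lemma prob_W1_gt_le:
  assumes CE2: "CE2 D P K f m s \<le> \<epsilon>" and "\<delta> > 0"
  shows "measure D {x \<in> space D. W1 K f m s (cell P x) > 2 * \<epsilon> / \<delta>} \<le> \<delta>"
proof -
  interpret D: prob_space D by (rule prob_space_distr[OF X])
  define Z where "Z = (\<lambda>x. delta1 K f m (cell P x) + delta2 K f m s (cell P x))"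
  have Z: "integrable D Z" "(\<integral>x. Z x \<partial>D) \<le> \<epsilon>" "\<And>x. Z x \<ge> 0"
    using integrable_calibration_error CE2 unfolding Z_def CE2_def
    by (auto simp: delta1_def delta2_def)
  have [measurable]: "Z \<in> borel_measurable D" using Z(1) by simp
  have "\<epsilon> \<ge> 0" using Z(2,3) Bochner_Integration.integral_nonneg[of D Z] by (meson order_trans)
  \<comment> \<open>Replacing \<open>W1\<close> by \<open>2 * Z\<close> leaves only the larger
    event, defined by the measurable \<open>Z\<close>, to be shown measurable.\<close>
  have "{x \<in> space D. W1 K f m s (cell P x) > 2 * \<epsilon> / \<delta>} \<subseteq> {x \<in> space D. Z x > \<epsilon> / \<delta>}"
  proof safe
    fix x assume "x \<in> space D" "W1 K f m s (cell P x) > 2 * \<epsilon> / \<delta>"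
    moreover from this have "W1 K f m s (cell P x) \<le> 2 * Z x"
      unfolding Z_def using cell_in(1)[OF partition] by (intro W1_le) auto
    ultimately show "Z x > \<epsilon> / \<delta>" by simp
  qed
  then have "measure D {x \<in> space D. W1 K f m s (cell P x) > 2 * \<epsilon> / \<delta>} \<le> measure D {x \<in> space D. Z x > \<epsilon> / \<delta>}"
    by (rule D.finite_measure_mono) measurable
  also have "\<dots> \<le> \<delta>"
  \<comment> \<open>Markov's inequality divides by the threshold
    \<open>\<epsilon> / \<delta>\<close>. At threshold 0 the integral of \<open>Z\<close> vanishes
    instead, so \<open>Z = 0\<close> almost everywhere and the event is null.\<close>
  proof (cases "\<epsilon> = 0")
    case True
    then have "(\<integral>x. Z x \<partial>D) = 0" using Z(2,3) by (intro antisym Bochner_Integration.integral_nonneg) auto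
    then have "AE x in D. Z x = 0" using Z by (subst (asm) integral_nonneg_eq_0_iff_AE) auto
    then have "measure D {x \<in> space D. Z x > \<epsilon> / \<delta>} = measure D {}"
      by (intro D.finite_measure_eq_AE) (use True in auto)
    then show ?thesis using \<open>\<delta> > 0\<close> by simp
  next
    case False
    then have pos: "\<epsilon> / \<delta> > 0" using \<open>\<epsilon> \<ge> 0\<close> \<open>\<delta> > 0\<close> by simp
    have "measure D {x \<in> space D. Z x > \<epsilon> / \<delta>} \<le> measure D {x \<in> space D. Z x \<ge> \<epsilon> / \<delta>}"
      by (rule D.finite_measure_mono) auto
    also have "\<dots> \<le> (\<integral>x. Z x \<partial>D) / (\<epsilon> / \<delta>)"
      using Z pos by (intro integral_Markov_inequality_measure[where A = "{}"]) auto
    also have "\<dots> \<le> \<epsilon> / (\<epsilon> / \<delta>)" using Z(2) pos by (intro divide_right_mono) auto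
    also have "\<dots> = \<delta>" using False by simp
    finally show ?thesis .
  qed
  finally show ?thesis .
qed

end

section \<open>Failure of worst-case bounds\<close>

text \<open>The point 1 has mass \<open>t\<close> and label 1, the point 0 has the remaining mass
  and label 0, and the predictor is constantly 0. Both errors are 1 on the cell \<open>- {0}\<close>
  and 0 on \<open>{0}\<close>. Both cells have positive mass, so the failure does not come from a
  choice of conditional laws on null cells.\<close>

lemma worst_case_counterexample:
  assumes t: "0 < t" "t < 1"
  obtains \<Omega> S :: "nat measure" and X Y f P K m s and c
  where "higher_order_setup \<Omega> S X Y f P K m s" "\<forall>c\<in>P. measure (distr \<Omega> S X) c > 0"
    "CE2 (distr \<Omega> S X) P K f m s = 2 * t" "c \<in> P" "W1 K f m s c = 2"
proof -
  define p :: "nat pmf" where "p = map_pmf of_bool (bernoulli_pmf t)"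
  define S :: "nat measure" where "S = count_space UNIV"
  define f :: "nat \<Rightarrow> real" where "f x = of_bool (x \<noteq> 0)" for x
  define P :: "nat set set" where "P = {{0}, - {0}}"
  define D where "D = distr (measure_pmf p) S id"
  define K where "K = uniform_measure D"
  define z :: "nat set \<Rightarrow> real" where "z = (\<lambda>_. 0)"
  have part: "partition_on UNIV P"
    by (auto simp: P_def partition_on_def disjoint_def)
  have D_eq: "D = measure_pmf p"
    unfolding D_def S_def by (intro measure_eqI) (auto simp: emeasure_distr)
  interpret D: prob_space D unfolding D_eq by unfold_locales
  have prob: "measure D {0} = 1 - t" "measure D (- {0}) = t"
  proof -
    have "of_bool -` (- {0 :: nat}) = {True}" by auto
    then show "measure D (- {0}) = t"
      unfolding D_eq p_def measure_map_pmf using t by (simp add: measure_pmf_single)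
    then show "measure D {0} = 1 - t"
      using D.prob_compl[of "{0}"] by (simp add: D_eq Compl_eq_Diff_UNIV)
  qed
  have pos: "measure D c > 0" if "c \<in> P" for c
    using that prob t by (auto simp: P_def)
  have cond: "conditional_laws D P K"
    unfolding K_def using part pos
    by (intro conditional_laws_uniform_measure D.prob_space_axioms) (auto simp: D_eq, auto simp: P_def)
  have Kc: "prob_space (K c)" "sets (K c) = UNIV" "AE x in K c. x \<in> c" if "c \<in> P" for c
  proof -
    show 1: "prob_space (K c)" "sets (K c) = UNIV"
      using cond that by (auto simp: conditional_laws_def space_prob_algebra D_eq)
    interpret Kc: prob_space "K c" by (fact 1)
    show "AE x in K c. x \<in> c"
      using cond that by (intro Kc.AE_prob_1) (simp add: conditional_laws_def measure_def)
  qed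
  \<comment> \<open>\<open>f\<close> is constantly 0 or 1 on each cell, so its positive powers
    agree; \<open>j > 0\<close> excludes \<open>0 ^ 0 = 1\<close>.\<close>
  have eta: "eta K f j c = of_bool (c \<noteq> {0})" if "c \<in> P" "j > 0" for j c
  proof -
    interpret Kc: prob_space "K c" by (rule Kc[OF that(1)])
    have "eta K f j c = (\<integral>x. of_bool (c \<noteq> {0}) \<partial>K c)"
      unfolding eta_def
    proof (rule integral_cong_AE)
      show "AE x in K c. f x ^ j = of_bool (c \<noteq> {0})"
        using Kc(3)[OF that(1)] by eventually_elim (use that in \<open>auto simp: P_def f_def\<close>)
    qed (use Kc(2)[OF that(1)] in \<open>auto simp: measurable_def\<close>)
    then show ?thesis by (simp add: Kc.prob_space)
  qed
  have hos: "higher_order_setup (measure_pmf p) S id (\<lambda>x. x \<noteq> 0) f P K z z"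
  proof (intro higher_order_setup.intro higher_order_setup_axioms.intro)
    let ?F = "vimage_algebra (space (measure_pmf p)) id S"
    \<comment> \<open>As \<open>X = id\<close>, the label is a function of \<open>X\<close>: its
      indicator is \<open>f\<close>, which is measurable for \<open>?F\<close> and hence its own
      conditional expectation.\<close>
    have "subalgebra (measure_pmf p) ?F" by (simp add: subalgebra_def)
    then interpret F: finite_measure_subalgebra "measure_pmf p" ?F
      by unfold_locales
    have f_eq: "(\<lambda>\<omega>. of_bool (\<omega> \<noteq> 0)) = f" by (simp add: f_def fun_eq_iff)
    have "f \<in> borel_measurable ?F"
      using measurable_compose[OF measurable_vimage_algebra1[of id "UNIV" S], of f borel]
      by (simp add: S_def)
    moreover have "integrable (measure_pmf p) f"
      by (intro measure_pmf.integrable_const_bound[where B = 1]) (auto simp: f_def)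
    ultimately have "AE \<omega> in measure_pmf p. real_cond_exp (measure_pmf p) ?F f \<omega> = f \<omega>"
      by (intro F.real_cond_exp_F_meas)
    then show "AE \<omega> in measure_pmf p. f (id \<omega>) =
         real_cond_exp (measure_pmf p) ?F (\<lambda>\<omega>. of_bool (\<omega> \<noteq> 0)) \<omega>"
      unfolding f_eq by eventually_elim simp
  qed (use part cond in \<open>auto simp: S_def f_def z_def D_def measure_pmf.prob_space_axioms\<close>)
  have "CE2 D P K f z z = (\<integral>x. 2 * indicator (- {0}) x \<partial>D)"
    unfolding CE2_def
  proof (rule Bochner_Integration.integral_cong[OF refl])
    fix x
    have "cell P x \<in> P" "cell P x = {0} \<longleftrightarrow> x = 0"
      using cell_in[OF part, of x] by (auto simp: P_def)
    then show "delta1 K f z (cell P x) + delta2 K f z z (cell P x) = 2 * indicator (- {0}) x"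
      by (simp add: delta1_def delta2_def eta z_def second_moment_def)
  qed
  also have "\<dots> = 2 * t" using prob by (simp add: D_eq)
  finally have CE2: "CE2 D P K f z z = 2 * t" .
  have c: "- {0} \<in> P" by (simp add: P_def)
  \<comment> \<open>Predicted and true laws are point masses at the two ends of the snapshot space,
    at distance 2.\<close>
  have "snapshot_predictor z z (- {0}) = return_pmf 0"
    by (intro pmf_eqI, subst pmf_snapshot_predictor) (auto simp: z_def second_moment_def pmf_return)
  moreover have "proj2 K f (- {0}) = return_pmf 1"
    using Kc(1)[OF c] Kc(2)[OF c] eta[OF c]
    by (intro pmf_eqI, subst pmf_proj2(2)) (auto simp: pmf_return f_def measurable_def)
  ultimately have "W1 K f z z (- {0}) = 2"
    by (simp add: W1_def wasserstein1_return_pmf snapshot_dist_eq)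
  with that hos pos CE2 c show thesis unfolding D_def by blast
qed

text \<open>The negative part reaches every level below 2, the diameter of the snapshot space,
  however small \<open>\<epsilon> > 0\<close> is: only the trivial worst-case bound
  survives.\<close>

theorem mainTheorem11:
  shows "(\<forall>(\<Omega> :: 'w measure) (S :: 'x measure) X Y f P K m s (\<epsilon> :: real) (\<delta> :: real).
           higher_order_setup \<Omega> S X Y f P K m s \<longrightarrow>
           CE2 (distr \<Omega> S X) P K f m s \<le> \<epsilon> \<longrightarrow> \<delta> > 0 \<longrightarrow>
             measure (distr \<Omega> S X)
               {x \<in> space (distr \<Omega> S X). W1 K f m s (cell P x) > 2 * \<epsilon> / \<delta>} \<le> \<delta> \<and>
             (\<forall>\<epsilon>'. \<epsilon>' = 2 * \<epsilon> / \<delta> \<longrightarrow>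
               relaxed_calibrated (distr \<Omega> S X) P K f (snapshot_predictor m s) \<epsilon>' \<delta>))
       \<and> (\<forall>(\<epsilon> :: real) (\<epsilon>' :: real). \<epsilon> > 0 \<longrightarrow> \<epsilon>' < 2 \<longrightarrow>
           \<not> (\<forall>(\<Omega> :: nat measure) (S :: nat measure) X Y f P K m s.
                 higher_order_setup \<Omega> S X Y f P K m s \<longrightarrow>
                 (\<forall>c\<in>P. measure (distr \<Omega> S X) c > 0) \<longrightarrow>
                 CE2 (distr \<Omega> S X) P K f m s \<le> \<epsilon> \<longrightarrow>
                 worst_case_bound P K f m s \<epsilon>'))"
proof (intro conjI allI impI notI)
  fix \<Omega> :: "'w measure" and S :: "'x measure" and X Y f P K m s and \<epsilon> \<delta> \<epsilon>' :: real
  assume "higher_order_setup \<Omega> S X Y f P K m s"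
    and CE2: "CE2 (distr \<Omega> S X) P K f m s \<le> \<epsilon>" "\<delta> > 0"
  then interpret higher_order_setup \<Omega> S X Y f P K m s by blast
  show bound: "measure D {x \<in> space D. W1 K f m s (cell P x) > 2 * \<epsilon> / \<delta>} \<le> \<delta>"
    using CE2 by (rule prob_W1_gt_le)
  show "relaxed_calibrated D P K f (snapshot_predictor m s) \<epsilon>' \<delta>" if "\<epsilon>' = 2 * \<epsilon> / \<delta>"
    using bound by (simp add: relaxed_calibrated_def W1_def that)
next
  fix \<epsilon> \<epsilon>' :: real
  assume \<epsilon>: "\<epsilon> > 0" "\<epsilon>' < 2"
    and bound: "\<forall>(\<Omega> :: nat measure) (S :: nat measure) X Y f P K m s.
                 higher_order_setup \<Omega> S X Y f P K m s \<longrightarrow>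
                 (\<forall>c\<in>P. measure (distr \<Omega> S X) c > 0) \<longrightarrow>
                 CE2 (distr \<Omega> S X) P K f m s \<le> \<epsilon> \<longrightarrow>
                 worst_case_bound P K f m s \<epsilon>'"
  \<comment> \<open>\<open>\<epsilon> / 2\<close> makes \<open>CE2 = 2 * t\<close> at most
    \<open>\<epsilon>\<close>; \<open>1/2\<close> keeps \<open>t < 1\<close>, so that the cell
    \<open>{0}\<close> has positive mass.\<close>
  define t where "t = min (1/2) (\<epsilon> / 2)"
  have t: "0 < t" "t < 1" "2 * t \<le> \<epsilon>" using \<epsilon> by (auto simp: t_def)
  obtain \<Omega> S :: "nat measure" and X Y f P K m s and c
    where "higher_order_setup \<Omega> S X Y f P K m s" "\<forall>c\<in>P. measure (distr \<Omega> S X) c > 0"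
      "CE2 (distr \<Omega> S X) P K f m s = 2 * t" and c: "c \<in> P" "W1 K f m s c = 2"
    by (rule worst_case_counterexample[OF t(1,2)])
  then have "worst_case_bound P K f m s \<epsilon>'" using bound t(3) by simp
  then show False using c \<epsilon> by (auto simp: worst_case_bound_def)
qed

end
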